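(* Let $d\geq 1$ be an integer, let $A=(A(i,j))_{1\leq i,j\leq d}$ be a real square matrix with positive entries, and let $i\in\{1,\dots,d\}$. Let $\lambda_i$ be the unique positive real number such that $\phi_i(\lambda_i)=1$, and let $\mu_i=(\mu_i(j))_{1\le j\le d}$ be the vector defined by $$\forall j\in\{1,\dots,d\}\qquad \mu_i(j)=E_i\Bigg(\sum_{n=0}^{\tau_i-1}\Big(1_{\{X_n=j\}}\,\lambda_i^{-n}\prod_{k=0}^{n-1}S(X_k)\Big)\Bigg),$$ where $\phi_i$, $E_i$, $\tau_i$, $(X_n)_{n\in\mathbb{N}}$ and $S$ are associated to $A$ as in the context. Then $\lambda_i$ is an eigenvalue of $A$, and $\mu_i$ is an associated left eigenvector (that is, $\mu_i A=\lambda_i\mu_i$) whose components are all positive and finite.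
   Context: Let $A=(A(i,j))_{1\leq i,j\leq d}$ be a $d\times d$ real matrix with all entries positive. For $i\in\{1,\dots,d\}$ set $S(i)=\sum_{j=1}^d A(i,j)$ and for $i,j\in\{1,\dots,d\}$ set $M(i,j)=A(i,j)/S(i)$, so that $M=(M(i,j))_{1\le i,j\le d}$ is a stochastic matrix. Let $(X_n)_{n\in\mathbb{N}}$ ($\mathbb{N}=\{0,1,2,\dots\}$) be a Markov chain with state space $\{1,\dots,d\}$ and transition matrix $M$. For $i\in\{1,\dots,d\}$, $E_i$ denotes the expectation for the chain started from $X_0=i$, and $\tau_i=\inf\{n\geq 1: X_n=i\}$ is the time of first return to $i$. The function $\phi_i$ is defined, with values in $[0,+\infty]$, by $$\forall\lambda\geq 0\qquad \phi_i(\lambda)=E_i\Bigg(\lambda^{-\tau_i}\prod_{n=0}^{\tau_i-1}S(X_n)\Bigg).$$ There exists a unique positive real number $\lambda_i$ such that $\phi_i(\lambda_i)=1$. Empty products are equal to $1$. A left eigenvector of $A$ associated to $\lambda$ is a non-zero row vector $\nu$ with $\nu A=\lambda\nu$. *)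

theory Defs
  imports "HOL-Probability.Probability"
begin

definition row_total :: "real^'d^'d \<Rightarrow> 'd::finite \<Rightarrow> real" where
  "row_total A i = (\<Sum>j\<in>UNIV. A $ i $ j)"

definition normalized_matrix :: "real^'d^'d \<Rightarrow> real^'d^'d" where
  "normalized_matrix A = (\<chi> i j. A $ i $ j / row_total A i)"

definition markov_chain :: "'w measure \<Rightarrow> (nat \<Rightarrow> 'w \<Rightarrow> 'd) \<Rightarrow> real^'d^'d \<Rightarrow> bool" where
  "markov_chain P X T \<longleftrightarrow>
     prob_space P \<and>
     (\<forall>n. X n \<in> measurable P (count_space UNIV)) \<and>
     (\<forall>n x j. \<P>(\<omega> in P. \<forall>k\<le>n. X k \<omega> = x k) > 0 \<longrightarrow>
        \<P>(\<omega> in P. X (Suc n) \<omega> = j \<bar> \<forall>k\<le>n. X k \<omega> = x k) = T $ x n $ j)"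

definition return_time :: "(nat \<Rightarrow> 'w \<Rightarrow> 'd) \<Rightarrow> 'd \<Rightarrow> 'w \<Rightarrow> enat" where
  "return_time X i \<omega> = (INF n\<in>{n. 1 \<le> n \<and> X n \<omega> = i}. enat n)"

(* Weights live in ennreal, so that 0 has inverse \<infinity> (relevant only for l = 0). *)
definition path_weight :: "real^'d^'d \<Rightarrow> (nat \<Rightarrow> 'w \<Rightarrow> 'd) \<Rightarrow> real \<Rightarrow> nat \<Rightarrow> 'w \<Rightarrow> ennreal" where
  "path_weight A X l n \<omega> = inverse (ennreal l) ^ n * (\<Prod>k<n. ennreal (row_total A (X k \<omega>)))"

(* For a chain with positive transition matrix the return time is almost surely finite,
   so the value chosen on the event of no return is immaterial. *)
definition phi :: "real^'d^'d \<Rightarrow> 'w measure \<Rightarrow> (nat \<Rightarrow> 'w \<Rightarrow> 'd) \<Rightarrow> 'd \<Rightarrow> real \<Rightarrow> ennreal" where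
  "phi A P X i l =
     (\<integral>\<^sup>+ \<omega>. (case return_time X i \<omega> of enat m \<Rightarrow> path_weight A X l m \<omega> | \<infinity> \<Rightarrow> 0) \<partial>P)"

definition lambda_of :: "real^'d^'d \<Rightarrow> 'w measure \<Rightarrow> (nat \<Rightarrow> 'w \<Rightarrow> 'd) \<Rightarrow> 'd \<Rightarrow> real" where
  "lambda_of A P X i = (THE l. 0 < l \<and> phi A P X i l = 1)"

(* The sum over 0 \<le> n < return time is a series whose terms vanish from the return time on. *)
definition mu_of :: "real^'d^'d \<Rightarrow> 'w measure \<Rightarrow> (nat \<Rightarrow> 'w \<Rightarrow> 'd) \<Rightarrow> 'd \<Rightarrow> 'd \<Rightarrow> ennreal" where
  "mu_of A P X i j =
     (\<integral>\<^sup>+ \<omega>. (\<Sum>n. if enat n < return_time X i \<omega>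
                then indicator {\<omega>. X n \<omega> = j} \<omega> * path_weight A X (lambda_of A P X i) n \<omega>
                else 0) \<partial>P)"

definition eigenvalue :: "real^'d^'d \<Rightarrow> real \<Rightarrow> bool" where
  "eigenvalue A l \<longleftrightarrow> (\<exists>v. v \<noteq> 0 \<and> A *v v = l *s v)"

definition left_eigenvector :: "real^'d^'d \<Rightarrow> real^'d \<Rightarrow> real \<Rightarrow> bool" where
  "left_eigenvector A v l \<longleftrightarrow> v \<noteq> 0 \<and> v v* A = l *s v"

end

theory Submission
  imports Defs
begin

text \<open>
  The Markov property turns the excursion expectations into power series whose coefficients are sums
  of products of entries of \<open>A\<close> over paths from \<open>i\<close> that avoid \<open>i\<close> after time \<open>0\<close>. With \<open>r\<close> and
  \<open>h\<close> a positive right eigenpair of \<open>A\<close>, a Doob transform by \<open>h\<close> shows that the return series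
  takes the value \<open>1\<close> at \<open>r\<close>; being strictly decreasing, it does so nowhere else. One step of the path recursion
  then multiplies \<open>\<mu>\<^sub>i\<close> by \<open>r\<close>, the entry at \<open>i\<close> being restored by \<open>\<phi>\<^sub>i(r) = 1\<close>.
\<close>

section \<open>Existence of a positive right eigenpair\<close>

text \<open>Brouwer's theorem applies on the probability simplex to the map sending \<open>x\<close>
  to \<open>A *v x\<close> rescaled to total mass 1. A fixed point is an eigenvector for
  \<open>t h\<close>, and being a positive multiple of an image under \<open>A\<close> it has no
  zero entry.\<close>

lemma perron_right_eigenvector:
  fixes A :: "real^'d^'d"
  assumes pos: "\<And>j k. 0 < A $ j $ k"
  obtains r h where "0 < r" "\<And>j. 0 < h $ j" "A *v h = r *s h"
proof -
  define D where "D = {x :: real^'d. (\<forall>j. 0 \<le> x $ j) \<and> (\<Sum>j\<in>UNIV. x $ j) = 1}"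
  define t where "t = (\<lambda>x :: real^'d. \<Sum>j\<in>UNIV. (A *v x) $ j)"
  have image_pos: "0 < (A *v x) $ j" if "x \<in> D" for x j
  proof -
    have "\<exists>k. x $ k \<noteq> 0"
    proof (rule ccontr)
      assume "\<nexists>k. x $ k \<noteq> 0"
      with that show False
        by (simp add: D_def)
    qed
    then obtain k where "x $ k \<noteq> 0" ..
    then have "0 < x $ k"
      using that by (simp add: D_def less_le)
    then have "0 < A $ j $ k * x $ k"
      using pos by simp
    also have "\<dots> \<le> (\<Sum>k\<in>UNIV. A $ j $ k * x $ k)"
      using that pos by (intro member_le_sum) (auto simp: D_def intro: mult_nonneg_nonneg less_imp_le)
    finally show ?thesis
      by (simp add: matrix_vector_mult_def)
  qed
  have t_pos: "0 < t x" if "x \<in> D" for x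
    unfolding t_def by (intro sum_pos) (auto intro: image_pos that)
  define f where "f = (\<lambda>x. (1 / t x) *\<^sub>R (A *v x))"
  have "compact D"
    unfolding compact_eq_bounded_closed
  proof
    have "norm x \<le> 1" if "x \<in> D" for x
      using norm_le_l1_cart[of x] that by (simp add: D_def)
    then show "bounded D"
      by (auto simp: bounded_iff)
    show "closed D"
      unfolding D_def
      by (intro closed_Collect_conj closed_Collect_all closed_Collect_le closed_Collect_eq continuous_intros)
  qed
  moreover have "convex D"
    unfolding D_def convex_def
    by (auto simp: sum.distrib simp flip: sum_distrib_left)
  moreover have "D \<noteq> {}"
  proof -
    have "axis (undefined :: 'd) 1 \<in> D"
      by (simp add: D_def axis_def)
    then show ?thesis by auto
  qed
  moreover have "continuous_on D f"
    unfolding f_def t_def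
    by (intro continuous_intros matrix_vector_mult_linear_continuous_on) (use t_pos in \<open>force simp: t_def\<close>)
  moreover have "f \<in> D \<rightarrow> D"
  proof
    fix x assume x: "x \<in> D"
    have "(\<Sum>j\<in>UNIV. f x $ j) = t x / t x"
      by (simp add: f_def t_def flip: sum_divide_distrib)
    then show "f x \<in> D"
      using t_pos[OF x] image_pos[OF x] by (auto simp: D_def f_def intro: less_imp_le)
  qed
  ultimately obtain h where h: "h \<in> D" "f h = h"
    using brouwer by metis
  have eq: "A *v h = t h *s h"
    using h(2) t_pos[OF h(1)] by (auto simp: f_def vec_eq_iff field_simps)
  have "0 < h $ j" for j
    using image_pos[OF h(1), of j] t_pos[OF h(1)] by (simp add: eq zero_less_mult_iff)
  with eq t_pos[OF h(1)] show thesis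
    using that by blast
qed

section \<open>Weights of paths avoiding \<open>i\<close>\<close>

text \<open>An unnormalised taboo probability: the products of entries of \<open>A\<close> are
  summed over the paths of length \<open>n\<close> that start at \<open>i\<close> and avoid it at
  times 1 to \<open>n\<close>.\<close>

primrec taboo_weight :: "real^'d^'d \<Rightarrow> 'd::finite \<Rightarrow> nat \<Rightarrow> 'd \<Rightarrow> real" where
  "taboo_weight A i 0 j = (if j = i then 1 else 0)"
| "taboo_weight A i (Suc n) k =
     (if k = i then 0 else (\<Sum>j\<in>UNIV. taboo_weight A i n j * A $ j $ k))"

text \<open>\<open>return_weight A i n\<close> belongs to a first return at time \<open>n + 1\<close>.\<close>

definition return_weight :: "real^'d^'d \<Rightarrow> 'd::finite \<Rightarrow> nat \<Rightarrow> real" where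
  "return_weight A i n = (\<Sum>j\<in>UNIV. taboo_weight A i n j * A $ j $ i)"

lemma taboo_weight_nonneg:
  assumes "\<And>j k. 0 \<le> A $ j $ k"
  shows "0 \<le> taboo_weight A i n j"
  by (induction n arbitrary: j) (auto intro!: sum_nonneg mult_nonneg_nonneg assms)

lemma return_weight_nonneg:
  assumes "\<And>j k. 0 \<le> A $ j $ k"
  shows "0 \<le> return_weight A i n"
  unfolding return_weight_def
  by (intro sum_nonneg mult_nonneg_nonneg taboo_weight_nonneg assms)

text \<open>Multiplication by \<open>A\<close> extends the surviving paths freely: those arriving at
  \<open>i\<close> close an excursion, the others survive. The left eigenvector equation comes from
  summing this over \<open>n\<close>.\<close>

lemma taboo_step:
  "(\<Sum>j\<in>UNIV. taboo_weight A i n j * A $ j $ k) =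
     (if k = i then return_weight A i n else taboo_weight A i (Suc n) k)"
  by (simp add: return_weight_def)

lemma return_weight_0: "return_weight A i 0 = A $ i $ i"
  by (simp add: return_weight_def if_distrib[of "\<lambda>x. x * _"] cong: if_cong)

lemma taboo_weight_1:
  assumes "j \<noteq> i"
  shows "taboo_weight A i 1 j = A $ i $ j"
  using assms by (simp add: if_distrib[of "\<lambda>x. x * _"] cong: if_cong)

section \<open>Power series at the eigenvalue \<open>r\<close>\<close>

text \<open>
  Weighting the endpoints by the right eigenvector \<open>h\<close> turns the scaled taboo weights into a
  subprobability (Doob transform): the mass lost in each step is the return weight, and since
  \<open>i\<close> is reachable from everywhere in one step a fixed proportion is lost each time.
\<close>

context
  fixes A :: "real^'d^'d" and i :: 'd and r :: real and h :: "real^'d"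
  assumes pos: "\<And>j k. 0 < A $ j $ k"
    and r_pos: "0 < r" and h_pos: "\<And>j. 0 < h $ j" and eigen: "A *v h = r *s h"
begin

private definition u where "u n = (\<Sum>j\<in>UNIV. taboo_weight A i n j * h $ j) / r ^ n"

private lemma u_Suc: "u (Suc n) = u n - h $ i * (return_weight A i n / r ^ Suc n)"
proof -
  let ?w = "taboo_weight A i n"
  have "(\<Sum>k\<in>UNIV. taboo_weight A i (Suc n) k * h $ k) + return_weight A i n * h $ i
      = (\<Sum>k\<in>UNIV. (\<Sum>j\<in>UNIV. ?w j * A $ j $ k) * h $ k)"
    unfolding taboo_step
    by (subst (1 2) sum.remove[of UNIV i]) (auto intro: sum.cong)
  \<comment> \<open>Swapping the sums lets \<open>A\<close> act on \<open>h\<close>, which yields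
    the factor \<open>r\<close>.\<close>
  also have "\<dots> = (\<Sum>j\<in>UNIV. ?w j * (\<Sum>k\<in>UNIV. A $ j $ k * h $ k))"
    unfolding sum_distrib_left sum_distrib_right mult.assoc by (rule sum.swap)
  also have "\<dots> = r * (\<Sum>j\<in>UNIV. ?w j * h $ j)"
  proof -
    have "(\<Sum>k\<in>UNIV. A $ j $ k * h $ k) = r * h $ j" for j
      using arg_cong[OF eigen, of "\<lambda>v. v $ j"] by (simp add: matrix_vector_mult_def)
    then show ?thesis
      by (simp add: sum_distrib_left mult_ac)
  qed
  finally show ?thesis
    using r_pos unfolding u_def by (simp add: field_simps del: taboo_weight.simps)
qed

private lemma u_nonneg: "0 \<le> u n"
  unfolding u_def using pos h_pos r_pos
  by (intro divide_nonneg_nonneg sum_nonneg mult_nonneg_nonneg taboo_weight_nonneg)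
    (auto intro: less_imp_le)

private lemma u_decay: "\<exists>c. 0 \<le> c \<and> c < 1 \<and> (\<forall>n. u n \<le> c ^ n * u 0)"
proof -
  \<comment> \<open>The least probability, over the current state \<open>j\<close>, that the chain
    transformed by \<open>h\<close> jumps to \<open>i\<close>.\<close>
  define e where "e = Min (range (\<lambda>j. A $ j $ i * h $ i / (r * h $ j)))"
  have e_pos: "0 < e"
    unfolding e_def using pos r_pos h_pos by (subst Min_gr_iff) auto
  have e_le: "e * (r * h $ j) \<le> A $ j $ i * h $ i" for j
  proof -
    have "e \<le> A $ j $ i * h $ i / (r * h $ j)"
      unfolding e_def by (rule Min_le) auto
    then show ?thesis
      using r_pos h_pos[of j] by (simp add: pos_le_divide_eq)
  qed
  have step: "u (Suc n) \<le> (1 - e) * u n" for n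
  proof -
    have "e * r * (\<Sum>j\<in>UNIV. taboo_weight A i n j * h $ j)
        = (\<Sum>j\<in>UNIV. taboo_weight A i n j * (e * (r * h $ j)))"
      by (simp add: sum_distrib_left mult_ac)
    also have "\<dots> \<le> (\<Sum>j\<in>UNIV. taboo_weight A i n j * (A $ j $ i * h $ i))"
      using pos by (intro sum_mono mult_left_mono e_le taboo_weight_nonneg) (auto intro: less_imp_le)
    also have "\<dots> = h $ i * return_weight A i n"
      by (simp add: return_weight_def sum_distrib_left mult_ac)
    finally have "e * u n \<le> h $ i * (return_weight A i n / r ^ Suc n)"
      using r_pos unfolding u_def by (simp add: field_simps)
    then show ?thesis
      unfolding u_Suc by (simp add: algebra_simps)
  qed
  define c where "c = max 0 (1 - e)"
  have "u n \<le> c ^ n * u 0" for n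
  proof (induction n)
    case (Suc n)
    have "u (Suc n) \<le> c * u n"
      using step[of n] mult_right_mono[OF max.cobounded2 u_nonneg[of n], of "1 - e" 0] by (simp add: c_def)
    also have "\<dots> \<le> c * (c ^ n * u 0)"
      using Suc by (intro mult_left_mono) (auto simp: c_def)
    finally show ?case by (simp add: mult_ac)
  qed simp
  moreover have "0 \<le> c" "c < 1"
    using e_pos by (auto simp: c_def)
  ultimately show ?thesis by blast
qed

text \<open>The losses of \<open>u\<close> telescope and, as \<open>u\<close> tends to 0, add up to
  \<open>u 0 = h $ i\<close>. In other words, the transformed chain returns to \<open>i\<close>
  almost surely.\<close>

lemma return_weight_sums_1: "(\<lambda>n. return_weight A i n / r ^ Suc n) sums 1"
proof -
  obtain c where c: "0 \<le> c" "c < 1" "\<And>n. u n \<le> c ^ n * u 0"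
    using u_decay by blast
  have "(\<lambda>n. c ^ n * u 0) \<longlonglongrightarrow> 0 * u 0"
    using c by (intro tendsto_intros LIMSEQ_realpow_zero) auto
  then have "u \<longlonglongrightarrow> 0"
    using u_nonneg c(3) by (intro real_tendsto_sandwich[of "\<lambda>_. 0" u]) auto
  then have "(\<lambda>n. u n - u (Suc n)) sums (u 0 - 0)"
    by (rule telescope_sums')
  then have "(\<lambda>n. (u n - u (Suc n)) / h $ i) sums ((u 0 - 0) / h $ i)"
    by (rule sums_divide)
  moreover have "u 0 = h $ i"
    by (simp add: u_def if_distrib[of "\<lambda>x. x * _"] cong: if_cong)
  ultimately show ?thesis
    using h_pos[of i] by (simp add: u_Suc)
qed

text \<open>One endpoint carries at most the whole mass \<open>u n\<close>, which decays
  geometrically; dividing by \<open>h $ j > 0\<close> gives a summable bound.\<close>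

lemma taboo_weight_summable: "summable (\<lambda>n. taboo_weight A i n j / r ^ n)"
proof -
  obtain c where c: "0 \<le> c" "c < 1" "\<And>n. u n \<le> c ^ n * u 0"
    using u_decay by blast
  have bound: "taboo_weight A i n j / r ^ n \<le> c ^ n * u 0 / h $ j" for n
  proof -
    have "taboo_weight A i n j * h $ j \<le> (\<Sum>j\<in>UNIV. taboo_weight A i n j * h $ j)"
      using pos h_pos by (intro member_le_sum mult_nonneg_nonneg taboo_weight_nonneg)
        (auto intro: less_imp_le)
    then have "taboo_weight A i n j / r ^ n * h $ j \<le> u n"
      unfolding u_def using r_pos by (simp add: divide_right_mono)
    then show ?thesis
      using c(3)[of n] h_pos[of j] by (simp add: pos_le_divide_eq)
  qed
  show ?thesis
  proof (rule summable_comparison_test')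
    show "summable (\<lambda>n. c ^ n * u 0 / h $ j)"
      using c by (intro summable_divide summable_mult2 summable_geometric) auto
    show "norm (taboo_weight A i n j / r ^ n) \<le> c ^ n * u 0 / h $ j" if "n \<ge> 0" for n
      using bound[of n] taboo_weight_nonneg[of A i n j] pos r_pos by (simp add: less_imp_le)
  qed
qed

text \<open>By \<open>taboo_step\<close>, multiplication by \<open>A\<close> shifts the series by
  one index, whence the factor \<open>r\<close>. For \<open>k \<noteq> i\<close> the shift drops
  only the term at 0, which is zero. For \<open>k = i\<close> the series consists of its initial
  term 1, which the total return weight 1 replaces.\<close>

lemma taboo_weight_suminf_left_eigen:
  "(\<Sum>j\<in>UNIV. (\<Sum>n. taboo_weight A i n j / r ^ n) * A $ j $ k) = r * (\<Sum>n. taboo_weight A i n k / r ^ n)"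
proof -
  have "(\<Sum>j\<in>UNIV. (\<Sum>n. taboo_weight A i n j / r ^ n) * A $ j $ k)
      = (\<Sum>n. \<Sum>j\<in>UNIV. taboo_weight A i n j / r ^ n * A $ j $ k)"
    by (subst suminf_sum) (simp_all only: suminf_mult2 summable_mult2 taboo_weight_summable)
  also have "\<dots> = (\<Sum>n. r * ((\<Sum>j\<in>UNIV. taboo_weight A i n j * A $ j $ k) / r ^ Suc n))"
    using r_pos by (simp add: sum_divide_distrib sum_distrib_left)
  also have "\<dots> = (\<Sum>n. r * ((if k = i then return_weight A i n else taboo_weight A i (Suc n) k) / r ^ Suc n))"
    unfolding taboo_step ..
  also have "\<dots> = r * (\<Sum>n. taboo_weight A i n k / r ^ n)"
  proof (cases "k = i")
    case True
    have "(\<lambda>n. taboo_weight A i n i / r ^ n) = (\<lambda>n. if n = 0 then 1 else 0)"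
      by (rule ext, case_tac n) auto
    then have "(\<Sum>n. taboo_weight A i n i / r ^ n) = 1"
      using sums_single[of 0 "\<lambda>_. 1 :: real"] by (simp add: sums_iff)
    moreover have "(\<Sum>n. r * (return_weight A i n / r ^ Suc n)) = r * 1"
      by (rule sums_unique[symmetric, OF sums_mult[OF return_weight_sums_1]])
    ultimately show ?thesis
      using True by (simp only: refl if_True)
  next
    case False
    then show ?thesis
      using suminf_split_head[OF taboo_weight_summable, of k]
        summable_Suc_iff[THEN iffD2, OF taboo_weight_summable, of k]
      by (simp add: suminf_mult del: power_Suc taboo_weight.simps(2) times_divide_eq_right)
  qed
  finally show ?thesis .
qed

text \<open>One positive term suffices: time 0 if \<open>j = i\<close>, otherwise the direct jump
  from \<open>i\<close> to \<open>j\<close>.\<close>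

lemma taboo_weight_suminf_pos: "0 < (\<Sum>n. taboo_weight A i n j / r ^ n)"
proof (rule suminf_pos2[OF taboo_weight_summable, where i = "if j = i then 0 else 1"])
  show "0 \<le> taboo_weight A i n j / r ^ n" for n
    using taboo_weight_nonneg[of A i n j] pos r_pos by (simp add: less_imp_le)
  show "0 < taboo_weight A i (if j = i then 0 else 1) j / r ^ (if j = i then 0 else 1)"
    using pos r_pos taboo_weight_1[of j i A] by (cases "j = i") auto
qed

text \<open>No term increases with \<open>l\<close>, and the first one strictly decreases because
  \<open>A $ i $ i > 0\<close>. Values in \<open>ennreal\<close> cover every \<open>l\<close> at
  which the real series diverges.\<close>

lemma return_weight_series_eq_1_iff:
  assumes l: "0 < l"
  shows "(\<Sum>n. ennreal (return_weight A i n / l ^ Suc n)) = 1 \<longleftrightarrow> l = r"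
proof -
  have nn: "0 \<le> return_weight A i n" for n
    by (intro return_weight_nonneg less_imp_le pos)
  have anti: "x = y" if xy: "0 < x" "x \<le> y"
    "(\<lambda>n. return_weight A i n / x ^ Suc n) sums 1" "(\<lambda>n. return_weight A i n / y ^ Suc n) sums 1" for x y
  proof (rule ccontr)
    assume "x \<noteq> y"
    with xy have "x < y" by simp
    have "(\<lambda>n. return_weight A i n / x ^ Suc n - return_weight A i n / y ^ Suc n) sums (1 - 1)"
      by (intro sums_diff xy)
    moreover have "0 \<le> return_weight A i n / x ^ Suc n - return_weight A i n / y ^ Suc n" for n
    proof -
      have "x ^ Suc n \<le> y ^ Suc n"
        using xy by (intro power_mono) auto
      then show ?thesis
        using xy nn[of n] by (auto intro!: divide_left_mono simp del: power_Suc)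
    qed
    moreover have "0 < return_weight A i 0 / x ^ Suc 0 - return_weight A i 0 / y ^ Suc 0"
      using pos[of i i] \<open>0 < x\<close> \<open>x < y\<close> by (simp add: return_weight_0 divide_strict_left_mono)
    ultimately show False
      using suminf_pos2[of "\<lambda>n. return_weight A i n / x ^ Suc n - return_weight A i n / y ^ Suc n" 0]
      by (simp add: sums_iff)
  qed
  \<comment> \<open>The comparison subtracts series, so the equation is moved to convergence over
    the reals.\<close>
  have "(\<Sum>n. ennreal (return_weight A i n / l ^ Suc n)) = 1
      \<longleftrightarrow> (\<lambda>n. return_weight A i n / l ^ Suc n) sums 1"
  proof
    assume *: "(\<Sum>n. ennreal (return_weight A i n / l ^ Suc n)) = 1"
    show "(\<lambda>n. return_weight A i n / l ^ Suc n) sums 1"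
      using summable_sums[OF summableI, of "\<lambda>n. ennreal (return_weight A i n / l ^ Suc n)"] nn l *
      by (subst sums_ennreal[symmetric]) (auto simp del: power_Suc)
  next
    assume "(\<lambda>n. return_weight A i n / l ^ Suc n) sums 1"
    then have "(\<lambda>n. ennreal (return_weight A i n / l ^ Suc n)) sums ennreal 1"
      using nn l by (subst sums_ennreal) (auto simp del: power_Suc)
    then show "(\<Sum>n. ennreal (return_weight A i n / l ^ Suc n)) = 1"
      by (simp add: sums_iff del: power_Suc)
  qed
  also have "\<dots> \<longleftrightarrow> l = r"
    using anti[of l r] anti[of r l] return_weight_sums_1 l r_pos by (metis linear)
  finally show ?thesis .
qed

end

section \<open>The Markov property for functions of a finite past\<close>

text \<open>The chain is specified only through conditional probabilities given a whole past of
  positive probability. Since \<open>G\<close> sees only times up to \<open>n\<close> and there are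
  finitely many states, both integrals split into finite sums over pasts, compared term by
  term.\<close>

lemma markov_chain_nn_integral_step:
  fixes X :: "nat \<Rightarrow> 'w \<Rightarrow> 'd::finite" and T :: "real^'d^'d"
  assumes mc: "markov_chain P X T" and T: "\<And>j k. 0 \<le> T $ j $ k"
    and G: "\<And>x y. (\<And>m. m \<le> n \<Longrightarrow> x m = y m) \<Longrightarrow> G x = (G y :: ennreal)"
  shows "(\<integral>\<^sup>+\<omega>. G (\<lambda>m. X m \<omega>) * indicator {\<omega>. X (Suc n) \<omega> = k} \<omega> \<partial>P)
    = (\<integral>\<^sup>+\<omega>. G (\<lambda>m. X m \<omega>) * ennreal (T $ X n \<omega> $ k) \<partial>P)"
proof -
  interpret prob_space P
    using mc by (simp add: markov_chain_def)
  have X[measurable]: "X m \<in> measurable P (count_space UNIV)" for m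
    using mc by (simp add: markov_chain_def)
  define E where "E x = {\<omega>\<in>space P. \<forall>m\<le>n. X m \<omega> = x m}" for x
  define F where "F x = {\<omega>\<in>space P. X (Suc n) \<omega> = k \<and> (\<forall>m\<le>n. X m \<omega> = x m)}" for x
  have [measurable]: "E x \<in> sets P" "F x \<in> sets P" for x
    unfolding E_def F_def by measurable
  have F: "emeasure P (F x) = ennreal (T $ x n $ k) * emeasure P (E x)" for x
  proof (cases "prob (E x) > 0")
    case True
    then have "prob (F x) / prob (E x) = T $ x n $ k"
      using mc by (auto simp: markov_chain_def cond_prob_def E_def F_def)
    with True have "prob (F x) = T $ x n $ k * prob (E x)"
      by (simp add: field_simps)
    then show ?thesis
      using T by (simp add: emeasure_eq_measure ennreal_mult)
  next
    \<comment> \<open>Given a null past the conditional probability says nothing, but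
      \<open>F x\<close> lies inside \<open>E x\<close>, so both are null.\<close>
    case False
    then have "prob (E x) = 0"
      by (simp add: zero_less_measure_iff)
    moreover have "prob (F x) \<le> prob (E x)"
      by (intro finite_measure_mono) (auto simp: E_def F_def)
    ultimately show ?thesis
      by (simp add: emeasure_eq_measure measure_le_0_iff)
  qed
  \<comment> \<open>Extensional functions represent each past exactly once, so the sum over
    \<open>Q\<close> is finite and has one active term at each sample point.\<close>
  define Q where "Q = PiE {..n} (\<lambda>_. UNIV :: 'd set)"
  have "finite Q"
    unfolding Q_def by (intro finite_PiE) auto
  \<comment> \<open>Used with \<open>c\<close> constantly 1 for the left integral and with the
    transition probability for the right one.\<close>
  have decomp: "G (\<lambda>m. X m \<omega>) * c (X n \<omega>) = (\<Sum>x\<in>Q. G x * c (x n) * indicator (E x) \<omega>)"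
    if "\<omega> \<in> space P" for \<omega> and c :: "'d \<Rightarrow> ennreal"
  proof -
    define y where "y = restrict (\<lambda>m. X m \<omega>) {..n}"
    have "y \<in> Q"
      by (auto simp: y_def Q_def)
    have ind: "indicator (E x) \<omega> = (if x = y then 1 else (0 :: ennreal))" if "x \<in> Q" for x
      using that \<open>\<omega> \<in> space P\<close> by (auto simp: E_def y_def Q_def indicator_def PiE_def extensional_def fun_eq_iff)
    have "(\<Sum>x\<in>Q. G x * c (x n) * indicator (E x) \<omega>) = (\<Sum>x\<in>Q. if x = y then G x * c (x n) else 0)"
      by (intro sum.cong) (auto simp: ind)
    also have "\<dots> = G y * c (y n)"
      using \<open>finite Q\<close> \<open>y \<in> Q\<close> by simp
    also have "\<dots> = G (\<lambda>m. X m \<omega>) * c (X n \<omega>)"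
      using G[of y "\<lambda>m. X m \<omega>"] by (simp add: y_def)
    finally show ?thesis ..
  qed
  have "(\<integral>\<^sup>+\<omega>. G (\<lambda>m. X m \<omega>) * indicator {\<omega>. X (Suc n) \<omega> = k} \<omega> \<partial>P)
      = (\<integral>\<^sup>+\<omega>. (\<Sum>x\<in>Q. G x * indicator (F x) \<omega>) \<partial>P)"
  proof (intro nn_integral_cong)
    fix \<omega> assume \<omega>: "\<omega> \<in> space P"
    have "indicator (F x) \<omega> = indicator (E x) \<omega> * (indicator {\<omega>. X (Suc n) \<omega> = k} \<omega> :: ennreal)" for x
      using \<omega> by (auto simp: E_def F_def indicator_def)
    then show "G (\<lambda>m. X m \<omega>) * indicator {\<omega>. X (Suc n) \<omega> = k} \<omega> = (\<Sum>x\<in>Q. G x * indicator (F x) \<omega>)"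
      using decomp[OF \<omega>, of "\<lambda>_. 1"] by (simp add: sum_distrib_right mult.assoc)
  qed
  also have "\<dots> = (\<Sum>x\<in>Q. G x * emeasure P (F x))"
    by (simp add: nn_integral_sum nn_integral_cmult_indicator)
  also have "\<dots> = (\<Sum>x\<in>Q. G x * ennreal (T $ x n $ k) * emeasure P (E x))"
    by (simp add: F mult.assoc)
  also have "\<dots> = (\<integral>\<^sup>+\<omega>. (\<Sum>x\<in>Q. G x * ennreal (T $ x n $ k) * indicator (E x) \<omega>) \<partial>P)"
    by (simp add: nn_integral_sum nn_integral_cmult_indicator)
  also have "\<dots> = (\<integral>\<^sup>+\<omega>. G (\<lambda>m. X m \<omega>) * ennreal (T $ X n \<omega> $ k) \<partial>P)"
    by (intro nn_integral_cong decomp[symmetric])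
  finally show ?thesis .
qed

text \<open>This makes survival a condition on the past alone. Without any return the infimum is
  over the empty set, hence infinite, and both sides hold.\<close>

lemma less_return_time_iff: "enat n < return_time X i \<omega> \<longleftrightarrow> (\<forall>m\<in>{1..n}. X m \<omega> \<noteq> i)"
proof
  assume *: "enat n < return_time X i \<omega>"
  show "\<forall>m\<in>{1..n}. X m \<omega> \<noteq> i"
  proof (intro ballI notI)
    fix m assume "m \<in> {1..n}" "X m \<omega> = i"
    then have "return_time X i \<omega> \<le> enat m" "m \<le> n"
      by (auto simp: return_time_def intro: INF_lower)
    with * show False
      by (metis enat_ord_simps(1) leD order.trans)
  qed
next
  assume *: "\<forall>m\<in>{1..n}. X m \<omega> \<noteq> i"
  have "enat (Suc n) \<le> return_time X i \<omega>"
    unfolding return_time_def using * by (intro INF_greatest) (auto simp: not_less_eq_eq[symmetric])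
  then show "enat n < return_time X i \<omega>"
    using Suc_ile_eq by blast
qed

lemma return_time_eq_Suc_iff:
  "return_time X i \<omega> = enat (Suc n) \<longleftrightarrow> enat n < return_time X i \<omega> \<and> X (Suc n) \<omega> = i"
proof -
  have "return_time X i \<omega> = enat (Suc n)
      \<longleftrightarrow> enat n < return_time X i \<omega> \<and> \<not> enat (Suc n) < return_time X i \<omega>"
    by (cases "return_time X i \<omega>") auto
  also have "\<dots> \<longleftrightarrow> enat n < return_time X i \<omega> \<and> X (Suc n) \<omega> = i"
    unfolding less_return_time_iff by (auto simp: atLeastAtMostSuc_conv)
  finally show ?thesis .
qed

lemma return_time_neq_0: "return_time X i \<omega> \<noteq> enat 0"
  using less_return_time_iff[of 0 X i \<omega>] by auto

lemma path_weight_eq: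
  assumes "0 < l"
  shows "path_weight A X l n \<omega> = ennreal (1 / l ^ n) * (\<Prod>k<n. ennreal (row_total A (X k \<omega>)))"
  using assms by (simp add: path_weight_def inverse_ennreal ennreal_power power_inverse divide_inverse)

section \<open>Excursion expectations as power series\<close>

context
  fixes A :: "real^'d^'d" and i :: 'd
    and P :: "'w measure" and X :: "nat \<Rightarrow> 'w \<Rightarrow> 'd"
  assumes pos: "\<And>j k. 0 < A $ j $ k"
    and mc: "markov_chain P X (normalized_matrix A)"
    and start: "AE \<omega> in P. X 0 \<omega> = i"
begin

private lemma X_measurable[measurable]: "X n \<in> measurable P (count_space UNIV)"
  using mc by (simp add: markov_chain_def)

private lemma row_total_pos: "0 < row_total A j"
  unfolding row_total_def by (intro sum_pos) (auto simp: pos)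

text \<open>A functional of trajectories rather than of sample points, to fit the \<open>G\<close>
  of \<open>markov_chain_nn_integral_step\<close>. The powers of \<open>l\<close> are constants and
  stay outside.\<close>

private definition alive :: "nat \<Rightarrow> (nat \<Rightarrow> 'd) \<Rightarrow> ennreal" where
  "alive n x = (if \<forall>m\<in>{1..n}. x m \<noteq> i then \<Prod>k<n. ennreal (row_total A (x k)) else 0)"

private lemma alive_measurable[measurable]: "(\<lambda>\<omega>. alive n (\<lambda>m. X m \<omega>)) \<in> borel_measurable P"
  unfolding alive_def by measurable

text \<open>The row total at \<open>X n\<close> cancels the denominator of the transition
  probability and leaves an entry of \<open>A\<close>. The target \<open>k\<close> is arbitrary, so
  the same step serves survival and return; \<open>w\<close> is the induction hypothesis of
  \<open>nn_integral_alive\<close>.\<close>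

private lemma alive_step:
  assumes w: "\<And>j. (\<integral>\<^sup>+\<omega>. alive n (\<lambda>m. X m \<omega>) * indicator {\<omega>. X n \<omega> = j} \<omega> \<partial>P)
      = ennreal (taboo_weight A i n j)"
  shows "(\<integral>\<^sup>+\<omega>. alive n (\<lambda>m. X m \<omega>) * ennreal (row_total A (X n \<omega>)) * indicator {\<omega>. X (Suc n) \<omega> = k} \<omega> \<partial>P)
    = ennreal (\<Sum>j\<in>UNIV. taboo_weight A i n j * A $ j $ k)"
proof -
  let ?a = "\<lambda>\<omega>. alive n (\<lambda>m. X m \<omega>)"
  have "(\<integral>\<^sup>+\<omega>. ?a \<omega> * ennreal (row_total A (X n \<omega>)) * indicator {\<omega>. X (Suc n) \<omega> = k} \<omega> \<partial>P)
      = (\<integral>\<^sup>+\<omega>. ?a \<omega> * ennreal (row_total A (X n \<omega>)) * ennreal (normalized_matrix A $ X n \<omega> $ k) \<partial>P)"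
  proof (rule markov_chain_nn_integral_step[OF mc, where G = "\<lambda>x. alive n x * ennreal (row_total A (x n))"])
    show "0 \<le> normalized_matrix A $ j $ k" for j k
      using pos[of j k] row_total_pos[of j] by (simp add: normalized_matrix_def)
    show "alive n x * ennreal (row_total A (x n)) = alive n y * ennreal (row_total A (y n))"
      if "\<And>m. m \<le> n \<Longrightarrow> x m = y m" for x y
      using that by (auto simp: alive_def intro!: prod.cong)
  qed
  also have "\<dots> = (\<integral>\<^sup>+\<omega>. (\<Sum>j\<in>UNIV. ?a \<omega> * indicator {\<omega>. X n \<omega> = j} \<omega> * ennreal (A $ j $ k)) \<partial>P)"
  proof (intro nn_integral_cong)
    fix \<omega>
    have "ennreal (row_total A (X n \<omega>)) * ennreal (normalized_matrix A $ X n \<omega> $ k) = ennreal (A $ X n \<omega> $ k)"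
      using row_total_pos[of "X n \<omega>"] pos[of "X n \<omega>" k]
      by (simp add: normalized_matrix_def ennreal_mult[symmetric])
    moreover have "(\<Sum>j\<in>UNIV. ?a \<omega> * indicator {\<omega>. X n \<omega> = j} \<omega> * ennreal (A $ j $ k))
        = (\<Sum>j\<in>UNIV. if j = X n \<omega> then ?a \<omega> * ennreal (A $ j $ k) else 0)"
      by (intro sum.cong) (auto simp: indicator_def)
    ultimately show "?a \<omega> * ennreal (row_total A (X n \<omega>)) * ennreal (normalized_matrix A $ X n \<omega> $ k)
        = (\<Sum>j\<in>UNIV. ?a \<omega> * indicator {\<omega>. X n \<omega> = j} \<omega> * ennreal (A $ j $ k))"
      by (simp add: mult.assoc)
  qed
  also have "\<dots> = (\<Sum>j\<in>UNIV. ennreal (taboo_weight A i n j) * ennreal (A $ j $ k))"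
    by (simp add: nn_integral_sum nn_integral_multc w)
  also have "\<dots> = ennreal (\<Sum>j\<in>UNIV. taboo_weight A i n j * A $ j $ k)"
    using pos by (simp add: ennreal_mult[symmetric] sum_ennreal taboo_weight_nonneg less_imp_le)
  finally show ?thesis .
qed

private lemma nn_integral_alive:
  "(\<integral>\<^sup>+\<omega>. alive n (\<lambda>m. X m \<omega>) * indicator {\<omega>. X n \<omega> = j} \<omega> \<partial>P) = ennreal (taboo_weight A i n j)"
proof (induction n arbitrary: j)
  case 0
  interpret prob_space P
    using mc by (simp add: markov_chain_def)
  have "(\<integral>\<^sup>+\<omega>. alive 0 (\<lambda>m. X m \<omega>) * indicator {\<omega>. X 0 \<omega> = j} \<omega> \<partial>P)
      = (\<integral>\<^sup>+\<omega>. ennreal (taboo_weight A i 0 j) \<partial>P)"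
    using start by (intro nn_integral_cong_AE) (auto simp: alive_def elim!: eventually_mono)
  then show ?case
    by (simp add: emeasure_space_1)
next
  case (Suc n)
  \<comment> \<open>Arrival at \<open>i\<close> kills the path; otherwise the state at time
    \<open>n\<close> contributes its row total.\<close>
  have "alive (Suc n) (\<lambda>m. X m \<omega>) * indicator {\<omega>. X (Suc n) \<omega> = j} \<omega> =
      (if j = i then 0
       else alive n (\<lambda>m. X m \<omega>) * ennreal (row_total A (X n \<omega>)) * indicator {\<omega>. X (Suc n) \<omega> = j} \<omega>)" for \<omega>
    by (auto simp: alive_def indicator_def le_Suc_eq mult.commute)
  then show ?case
    using alive_step[OF Suc, of j] by (auto simp del: mult_eq_0_iff)
qed

lemma phi_eq_suminf:
  assumes "0 < l"
  shows "phi A P X i l = (\<Sum>n. ennreal (return_weight A i n / l ^ Suc n))"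
proof -
  let ?f = "\<lambda>n \<omega>. ennreal (1 / l ^ Suc n)
      * (alive n (\<lambda>m. X m \<omega>) * ennreal (row_total A (X n \<omega>)) * indicator {\<omega>. X (Suc n) \<omega> = i} \<omega>)"
  have f: "?f n \<omega> = (if return_time X i \<omega> = enat (Suc n) then path_weight A X l (Suc n) \<omega> else 0)" for n \<omega>
    using assms unfolding return_time_eq_Suc_iff less_return_time_iff
    by (auto simp: path_weight_eq alive_def mult_ac simp del: power_Suc)
  \<comment> \<open>Index \<open>n\<close> stands for a return at \<open>n + 1\<close>, so at most
    one term is nonzero. Without a return all terms vanish, in agreement with the default value
    0.\<close>
  have "(case return_time X i \<omega> of enat m \<Rightarrow> path_weight A X l m \<omega> | \<infinity> \<Rightarrow> 0) = (\<Sum>n. ?f n \<omega>)" for \<omega>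
  proof (cases "return_time X i \<omega>")
    case (enat m)
    then obtain m' where m': "m = Suc m'"
      using return_time_neq_0[of X i \<omega>] by (cases m) auto
    have "(\<Sum>n. ?f n \<omega>) = (\<Sum>n. if n = m' then path_weight A X l (Suc n) \<omega> else 0)"
      unfolding f enat m' by (intro arg_cong[of _ _ suminf]) auto
    also have "\<dots> = path_weight A X l (Suc m') \<omega>"
      using sums_single[of m' "\<lambda>n. path_weight A X l (Suc n) \<omega>"] by (simp add: sums_iff)
    finally show ?thesis
      by (simp add: enat m')
  qed (simp only: f, simp)
  then have "phi A P X i l = (\<integral>\<^sup>+\<omega>. (\<Sum>n. ?f n \<omega>) \<partial>P)"
    by (simp add: phi_def)
  also have "\<dots> = (\<Sum>n. \<integral>\<^sup>+\<omega>. ?f n \<omega> \<partial>P)"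
    by (intro nn_integral_suminf) measurable
  also have "\<dots> = (\<Sum>n. ennreal (1 / l ^ Suc n) * ennreal (return_weight A i n))"
    by (subst nn_integral_cmult) (measurable, simp only: alive_step[OF nn_integral_alive] return_weight_def)
  also have "\<dots> = (\<Sum>n. ennreal (return_weight A i n / l ^ Suc n))"
    using assms pos by (simp add: ennreal_mult[symmetric] return_weight_nonneg less_imp_le del: power_Suc)
  finally show ?thesis .
qed

lemma mu_of_eq_suminf:
  assumes l: "lambda_of A P X i = l" "0 < l"
  shows "mu_of A P X i j = (\<Sum>n. ennreal (taboo_weight A i n j / l ^ n))"
proof -
  have "mu_of A P X i j = (\<integral>\<^sup>+\<omega>. (\<Sum>n. ennreal (1 / l ^ n)
      * (alive n (\<lambda>m. X m \<omega>) * indicator {\<omega>. X n \<omega> = j} \<omega>)) \<partial>P)"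
    unfolding mu_of_def l(1) less_return_time_iff
    by (intro nn_integral_cong arg_cong[of _ _ suminf] ext)
      (auto simp: path_weight_eq[OF l(2)] alive_def indicator_def)
  also have "\<dots> = (\<Sum>n. \<integral>\<^sup>+\<omega>. ennreal (1 / l ^ n)
      * (alive n (\<lambda>m. X m \<omega>) * indicator {\<omega>. X n \<omega> = j} \<omega>) \<partial>P)"
    by (intro nn_integral_suminf) measurable
  also have "\<dots> = (\<Sum>n. ennreal (1 / l ^ n) * ennreal (taboo_weight A i n j))"
    by (subst nn_integral_cmult) (measurable, simp only: nn_integral_alive)
  also have "\<dots> = (\<Sum>n. ennreal (taboo_weight A i n j / l ^ n))"
    using l(2) pos by (simp add: ennreal_mult[symmetric] taboo_weight_nonneg less_imp_le)
  finally show ?thesis .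
qed

end

theorem theorem2:
  fixes A :: "real^'d^'d" and i :: 'd
    and P :: "'w measure" and X :: "nat \<Rightarrow> 'w \<Rightarrow> 'd"
  assumes "\<And>j k. 0 < A $ j $ k"
    and "markov_chain P X (normalized_matrix A)"
    and "AE \<omega> in P. X 0 \<omega> = i"
  shows "eigenvalue A (lambda_of A P X i)
    \<and> (\<forall>j. 0 < mu_of A P X i j \<and> mu_of A P X i j < \<infinity>)
    \<and> left_eigenvector A (\<chi> j. enn2real (mu_of A P X i j)) (lambda_of A P X i)"
proof -
  obtain r h where r: "0 < r" and h: "\<And>j. 0 < h $ j" and eigen: "A *v h = r *s h"
    using perron_right_eigenvector assms(1) by blast
  note perron = assms(1) r h eigen
  \<comment> \<open>Uniqueness lets the definite description in \<open>lambda_of\<close> evaluate to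
    \<open>r\<close>.\<close>
  have "0 < l \<and> phi A P X i l = 1 \<longleftrightarrow> l = r" for l
    using return_weight_series_eq_1_iff[OF perron, of l i] phi_eq_suminf[OF assms, of l] r by auto
  then have lambda: "lambda_of A P X i = r"
    by (simp add: lambda_of_def)
  define m where "m j = (\<Sum>n. taboo_weight A i n j / r ^ n)" for j
  have m_pos: "0 < m j" for j
    unfolding m_def by (rule taboo_weight_suminf_pos[OF perron])
  have mu: "mu_of A P X i j = ennreal (m j)" for j
    unfolding mu_of_eq_suminf[OF assms lambda r] m_def
    using assms(1) r
    by (intro suminf_ennreal2 taboo_weight_summable[OF perron] divide_nonneg_nonneg taboo_weight_nonneg)
      (auto intro: less_imp_le)
  have "(\<chi> j. m j) \<noteq> 0"
    using m_pos less_imp_neq by (fastforce simp: vec_eq_iff)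
  moreover have "(\<chi> j. m j) v* A = r *s (\<chi> j. m j)"
    using taboo_weight_suminf_left_eigen[OF perron, of i]
    by (simp add: vec_eq_iff vector_matrix_mult_def m_def mult.commute)
  ultimately have "left_eigenvector A (\<chi> j. enn2real (mu_of A P X i j)) r"
    using m_pos by (simp add: left_eigenvector_def mu less_imp_le)
  \<comment> \<open>\<open>eigenvalue\<close> refers to right eigenvectors, so its witness is
    \<open>h\<close>.\<close>
  moreover have "h \<noteq> 0"
    using h[of i] by auto
  ultimately show ?thesis
    using eigen m_pos by (auto simp: lambda mu eigenvalue_def)
qed

end
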